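(* Let $G$ be an amenable group and let $R$ be a ring graded by $G$. (a) Suppose that, for each $g\in G$, $R_g$ contains an element that is not a left zero divisor in $R$. If $R_1$ satisfies SRC, then $R$ satisfies SRC. (b) Suppose that, for each $g\in G$, $R_g$ contains an element that is not a right zero divisor in $R$. If $R_1$ satisfies LSRC, then $R$ satisfies LSRC.
   Context: Rings are associative with identity element $1$ and are not assumed commutative. Groups are discrete. A ring $R$ satisfies the strong rank condition (SRC) if, for every natural number $n$, there is no right $R$-module monomorphism $R^{n+1}\to R^n$. It satisfies the left strong rank condition (LSRC) if, for every natural number $n$, there is no left $R$-module monomorphism $R^{n+1}\to R^n$. A ring $R$ is graded by a group $G$ if the underlying additive group of $R$ is a direct sum $R=\bigoplus_{g\in G}R_g$ of abelian subgroups $R_g$ such that $R_gR_h\subseteq R_{gh}$ for all $g,h\in G$. In this case $R_1$ (the component at the identity of $G$) is a subring of $R$, called the base ring. An element $r\in R$ is a left zero divisor if $rs=0$ for some nonzero $s\in R$, and a right zero divisor if $sr=0$ for some nonzero $s\in R$. *)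

theory Defs
  imports "HOL-Algebra.Algebra"
begin

definition amenable :: "('g, 'm) monoid_scheme \<Rightarrow> bool" where
  "amenable G \<longleftrightarrow> group G \<and>
    (\<exists>\<mu> :: 'g set \<Rightarrow> real.
      (\<forall>A. A \<subseteq> carrier G \<longrightarrow> 0 \<le> \<mu> A) \<and>
      \<mu> (carrier G) = 1 \<and>
      (\<forall>A B. A \<subseteq> carrier G \<longrightarrow> B \<subseteq> carrier G \<longrightarrow> A \<inter> B = {} \<longrightarrow>
        \<mu> (A \<union> B) = \<mu> A + \<mu> B) \<and>
      (\<forall>g A. g \<in> carrier G \<longrightarrow> A \<subseteq> carrier G \<longrightarrow> \<mu> (g <#\<^bsub>G\<^esub> A) = \<mu> A))"

text \<open>
  The additive group of \<open>R\<^sup>n\<close> consists of the extensional functions from \<open>{..<n}\<close> to the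
  carrier of \<open>R\<close> with pointwise addition.  Scalars act coordinatewise, from the right or
  from the left.
\<close>

definition free_add_group :: "('a, 'm) ring_scheme \<Rightarrow> nat \<Rightarrow> (nat \<Rightarrow> 'a) monoid" where
  "free_add_group R n = product_group {..<n} (\<lambda>_. add_monoid R)"

definition right_smult ::
  "('a, 'm) ring_scheme \<Rightarrow> nat \<Rightarrow> (nat \<Rightarrow> 'a) \<Rightarrow> 'a \<Rightarrow> (nat \<Rightarrow> 'a)" where
  "right_smult R n x r = (\<lambda>i\<in>{..<n}. x i \<otimes>\<^bsub>R\<^esub> r)"

definition left_smult ::
  "('a, 'm) ring_scheme \<Rightarrow> nat \<Rightarrow> 'a \<Rightarrow> (nat \<Rightarrow> 'a) \<Rightarrow> (nat \<Rightarrow> 'a)" where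
  "left_smult R n r x = (\<lambda>i\<in>{..<n}. r \<otimes>\<^bsub>R\<^esub> x i)"

definition right_module_monos ::
  "('a, 'm) ring_scheme \<Rightarrow> nat \<Rightarrow> nat \<Rightarrow> ((nat \<Rightarrow> 'a) \<Rightarrow> (nat \<Rightarrow> 'a)) set" where
  "right_module_monos R m n =
    {f \<in> mon (free_add_group R m) (free_add_group R n).
      \<forall>x \<in> carrier (free_add_group R m). \<forall>r \<in> carrier R.
        f (right_smult R m x r) = right_smult R n (f x) r}"

definition left_module_monos ::
  "('a, 'm) ring_scheme \<Rightarrow> nat \<Rightarrow> nat \<Rightarrow> ((nat \<Rightarrow> 'a) \<Rightarrow> (nat \<Rightarrow> 'a)) set" where
  "left_module_monos R m n =
    {f \<in> mon (free_add_group R m) (free_add_group R n).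
      \<forall>x \<in> carrier (free_add_group R m). \<forall>r \<in> carrier R.
        f (left_smult R m r x) = left_smult R n r (f x)}"

definition SRC :: "('a, 'm) ring_scheme \<Rightarrow> bool" where
  "SRC R \<longleftrightarrow> (\<forall>n. \<not> (\<exists>f. f \<in> right_module_monos R (n + 1) n))"

definition LSRC :: "('a, 'm) ring_scheme \<Rightarrow> bool" where
  "LSRC R \<longleftrightarrow> (\<forall>n. \<not> (\<exists>f. f \<in> left_module_monos R (n + 1) n))"

definition left_zero_divisor :: "('a, 'm) ring_scheme \<Rightarrow> 'a \<Rightarrow> bool" where
  "left_zero_divisor R r \<longleftrightarrow>
    r \<in> carrier R \<and> (\<exists>s \<in> carrier R. s \<noteq> \<zero>\<^bsub>R\<^esub> \<and> r \<otimes>\<^bsub>R\<^esub> s = \<zero>\<^bsub>R\<^esub>)"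

definition right_zero_divisor :: "('a, 'm) ring_scheme \<Rightarrow> 'a \<Rightarrow> bool" where
  "right_zero_divisor R r \<longleftrightarrow>
    r \<in> carrier R \<and> (\<exists>s \<in> carrier R. s \<noteq> \<zero>\<^bsub>R\<^esub> \<and> s \<otimes>\<^bsub>R\<^esub> r = \<zero>\<^bsub>R\<^esub>)"

definition grade_support ::
  "('g, 'n) monoid_scheme \<Rightarrow> ('a, 'm) ring_scheme \<Rightarrow> ('g \<Rightarrow> 'a) \<Rightarrow> 'g set" where
  "grade_support G R x = {g \<in> carrier G. x g \<noteq> \<zero>\<^bsub>R\<^esub>}"

text \<open>
  The internal direct sum is expressed by unique decomposition: \<open>\<Pi>\<^sub>E\<close> pins the
  family of components down outside the carrier of \<open>G\<close>, so that uniqueness is meaningful.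
\<close>

locale graded_ring = G?: group G + R?: ring R
  for G :: "('g, 'n) monoid_scheme" and R :: "('a, 'm) ring_scheme" +
  fixes A :: "'g \<Rightarrow> 'a set"
  assumes component_additive_subgroup:
      "g \<in> carrier G \<Longrightarrow> additive_subgroup (A g) R"
    and unique_decomposition:
      "r \<in> carrier R \<Longrightarrow>
        \<exists>!x. x \<in> (\<Pi>\<^sub>E g\<in>carrier G. A g) \<and> finite (grade_support G R x) \<and>
             r = (\<Oplus>\<^bsub>R\<^esub>g\<in>grade_support G R x. x g)"
    and component_mult:
      "\<lbrakk>g \<in> carrier G; h \<in> carrier G; a \<in> A g; b \<in> A h\<rbrakk> \<Longrightarrow> a \<otimes>\<^bsub>R\<^esub> b \<in> A (g \<otimes>\<^bsub>G\<^esub> h)"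

definition base_ring ::
  "('g, 'n) monoid_scheme \<Rightarrow> ('a, 'm) ring_scheme \<Rightarrow> ('g \<Rightarrow> 'a set) \<Rightarrow> ('a, 'm) ring_scheme" where
  "base_ring G R A = R\<lparr>carrier := A \<one>\<^bsub>G\<^esub>\<rparr>"

end

theory Submission
  imports Defs
begin

text \<open>
  The strong rank condition says that a homogeneous linear system with more unknowns than
  equations, coefficients on the left, has a nonzero solution
  (\<open>SRC_imp_underdetermined_solvable\<close>, \<open>underdetermined_solvable_imp_SRC\<close>).  So let a system of
  \<open>n\<close> equations \<open>\<Sum>\<^sub>i m\<^sub>j\<^sub>i x\<^sub>i = 0\<close> in \<open>n + 1\<close> unknowns over \<open>R\<close> be given, and let \<open>F\<close> be the
  finite set of degrees in which some coefficient has a nonzero component.  Choose in each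
  component \<open>A g\<close> an element \<open>r\<^sub>g\<close> that is not a left zero divisor.  For a finite \<open>K \<subseteq> G\<close> a
  solution is sought in the form \<open>x\<^sub>i = \<Sum>\<^sub>g r\<^sub>g y\<^sub>i\<^sub>g\<close> with \<open>g \<in> K\<close> and \<open>y\<^sub>i\<^sub>g\<close> in the base ring.
  The left-hand side then lives in degrees \<open>h \<in> F K\<close>, and its component of degree \<open>h\<close> is a
  linear expression in the \<open>y\<^sub>i\<^sub>g\<close> with coefficients of degree \<open>h\<close>.  Multiplication from the left by
  \<open>r\<close> at \<open>h\<inverse>\<close> brings the coefficients into the base ring and, by the choice of \<open>r\<close>, loses no
  information.  What remains is a system of \<open>n |F K|\<close> equations in \<open>(n + 1) |K|\<close> unknowns over the
  base ring.  It has a nonzero solution \<open>y\<close> as soon as \<open>n |F K| < (n + 1) |K|\<close>, and then \<open>x\<close> is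
  nonzero too, since the terms \<open>r\<^sub>g y\<^sub>i\<^sub>g\<close> of \<open>x\<^sub>i\<close> have distinct degrees and none of the \<open>r\<^sub>g\<close> kills
  a nonzero element (\<open>underdetermined_solvable_graded\<close>).

  A set \<open>K\<close> with this property exists because \<open>G\<close> is amenable
  (\<open>amenable_small_expansion\<close>).  Suppose \<open>l |K| \<le> k |F K|\<close> for all finite \<open>K\<close>, with
  \<open>k < l\<close>.  This is Hall's condition for the graph that joins \<open>(g, i)\<close> with \<open>i < l\<close> to all
  \<open>(f g, j)\<close> with \<open>f \<in> F\<close> and \<open>j < k\<close>.  By Hall's theorem for infinite, locally finite graphs
  (\<open>hall_marriage\<close>) there is an injection of \<open>l\<close> copies of \<open>G\<close> into \<open>k\<close> copies of \<open>G\<close> that is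
  piecewise a left translation by an element of \<open>F\<close>.  An invariant mean does not allow this
  (\<open>amenable_no_paradoxical_injection\<close>).

  Part (b) is part (a) for the opposite ring, in which the component of degree \<open>g\<close> is taken to be
  \<open>A (g\<inverse>)\<close>, as the order of the factors is reversed.
\<close>

section \<open>Hall's marriage theorem for locally finite graphs\<close>

text \<open>
  Since \<open>card\<close> is \<open>0\<close> on infinite sets, this is the condition in Hall's theorem only for
  graphs in which every vertex of \<open>V\<close> has finitely many neighbours.
\<close>

definition hall_condition :: "'x set \<Rightarrow> ('x \<times> 'y) set \<Rightarrow> bool" where
  "hall_condition V E \<longleftrightarrow> (\<forall>S. finite S \<longrightarrow> S \<subseteq> V \<longrightarrow> card S \<le> card (E `` S))"

text \<open>
  This is Rado's step towards Hall's theorem.  Sets \<open>S\<close> and \<open>T\<close> that violate the condition after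
  the deletion of one and of the other edge both contain \<open>x\<close>.  Counting the neighbours of
  \<open>S \<union> T\<close> and of \<open>S \<inter> T - {x}\<close> in the undeleted graph then contradicts the modularity of
  \<open>card\<close>.
\<close>

lemma hall_condition_delete_edge:
  assumes fin: "\<And>x. x \<in> V \<Longrightarrow> finite (E `` {x})"
    and hall: "hall_condition V E"
    and x: "x \<in> V" and y: "y \<noteq> y'" "(x, y) \<in> E" "(x, y') \<in> E"
  shows "hall_condition V (E - {(x, y)}) \<or> hall_condition V (E - {(x, y')})"
proof (rule ccontr)
  assume "\<not> ?thesis"
  then obtain S T where
    S: "finite S" "S \<subseteq> V" "card ((E - {(x, y)}) `` S) < card S" and
    T: "finite T" "T \<subseteq> V" "card ((E - {(x, y')}) `` T) < card T"
    by (auto simp: hall_condition_def not_le)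
  have finE: "finite (E `` U)" if "finite U" "U \<subseteq> V" for U
  proof -
    have "E `` U = (\<Union>u\<in>U. E `` {u})" by auto
    then show ?thesis using that fin by auto
  qed
  have le: "card U \<le> card (E `` U)" if "finite U" "U \<subseteq> V" for U
    using hall that by (simp add: hall_condition_def)
  have xS: "x \<in> S"
  proof (rule ccontr)
    assume "x \<notin> S"
    then have "(E - {(x, y)}) `` S = E `` S" by auto
    then show False using S le[of S] by simp
  qed
  have xT: "x \<in> T"
  proof (rule ccontr)
    assume "x \<notin> T"
    then have "(E - {(x, y')}) `` T = E `` T" by auto
    then show False using T le[of T] by simp
  qed
  define P where "P = (E - {(x, y)}) `` S"
  define Q where "Q = (E - {(x, y')}) `` T"
  have "P \<subseteq> E `` S" "Q \<subseteq> E `` T" by (auto simp: P_def Q_def)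
  then have finP: "finite P" and finQ: "finite Q"
    using finE S T by (meson finite_subset)+
  \<comment> \<open>Every neighbour of \<open>x\<close> survives in one of the two graphs.\<close>
  have "E `` (S \<union> T) \<subseteq> P \<union> Q"
    using y xS xT by (auto simp: P_def Q_def)
  then have un: "card (S \<union> T) \<le> card (P \<union> Q)"
    using le[of "S \<union> T"] S T finP finQ card_mono[of "P \<union> Q" "E `` (S \<union> T)"] by force
  have "E `` (S \<inter> T - {x}) \<subseteq> P \<inter> Q"
    by (auto simp: P_def Q_def)
  then have int: "card (S \<inter> T) \<le> card (P \<inter> Q) + 1"
    using le[of "S \<inter> T - {x}"] S T finP xS xT
      card_mono[of "P \<inter> Q" "E `` (S \<inter> T - {x})"] card_Suc_Diff1[of "S \<inter> T" x] by force
  show False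
    using un int card_Un_Int[OF S(1) T(1)] card_Un_Int[OF finP finQ] S(3) T(3)
    unfolding P_def[symmetric] Q_def[symmetric] by linarith
qed

text \<open>
  Hall's condition for a finite set concerns finitely many edges only, so it survives the union
  of a chain of sets of deleted edges, and Zorn's lemma applies.
\<close>

lemma hall_condition_maximal_deletion:
  assumes fin: "\<And>x. x \<in> V \<Longrightarrow> finite (E `` {x})"
    and hall: "hall_condition V E"
  obtains D where "hall_condition V (E - D)"
    "\<And>D'. hall_condition V (E - D') \<Longrightarrow> D \<subseteq> D' \<Longrightarrow> D' = D"
proof -
  have "\<exists>M\<in>{D. hall_condition V (E - D)}. \<forall>D\<in>{D. hall_condition V (E - D)}. M \<subseteq> D \<longrightarrow> D = M"
  proof (rule subset_Zorn_nonempty)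
    show "{D. hall_condition V (E - D)} \<noteq> {}"
      using hall by (auto intro: exI[of _ "{}"])
    fix \<C> assume ne: "\<C> \<noteq> {}" and ch: "subset.chain {D. hall_condition V (E - D)} \<C>"
    have "card S \<le> card ((E - \<Union>\<C>) `` S)" if S: "finite S" "S \<subseteq> V" for S
    proof -
      define E' where "E' = E \<inter> S \<times> UNIV"
      have "E' = Sigma S (\<lambda>x. E `` {x})" by (auto simp: E'_def)
      then have "finite (E' \<inter> \<Union>\<C>)" using S fin by auto
      \<comment> \<open>Only finitely many edges leave \<open>S\<close>, so one member of the chain already deletes
        all those among them that the union deletes.\<close>
      then obtain D where D: "D \<in> \<C>" "E' \<inter> \<Union>\<C> \<subseteq> D"
        using finite_subset_Union_chain[OF _ _ ne ch] by blast
      have "(E - \<Union>\<C>) `` S = (E - D) `` S"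
        using D by (auto simp: E'_def)
      moreover have "hall_condition V (E - D)"
        using ch D by (auto simp: subset_chain_def)
      ultimately show ?thesis using S by (simp add: hall_condition_def)
    qed
    then show "\<Union>\<C> \<in> {D. hall_condition V (E - D)}" by (auto simp: hall_condition_def)
  qed
  then show thesis using that by blast
qed

text \<open>
  After a maximal deletion of edges every vertex in \<open>V\<close> has exactly one neighbour left: at most one
  because of \<open>hall_condition_delete_edge\<close>, at least one because of Hall's condition for singletons.
  The condition for pairs shows that distinct vertices keep distinct neighbours.
\<close>

theorem hall_marriage:
  assumes fin: "\<And>x. x \<in> V \<Longrightarrow> finite (E `` {x})"
    and hall: "hall_condition V E"
  shows "\<exists>\<phi>. inj_on \<phi> V \<and> (\<forall>x\<in>V. (x, \<phi> x) \<in> E)"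
proof -
  obtain D where D: "hall_condition V (E - D)"
    "\<And>D'. hall_condition V (E - D') \<Longrightarrow> D \<subseteq> D' \<Longrightarrow> D' = D"
    using hall_condition_maximal_deletion[OF fin hall] by blast
  define M where "M = E - D"
  have hallM: "hall_condition V M" using D by (simp add: M_def)
  have finM: "finite (M `` {x})" if "x \<in> V" for x
    by (rule finite_subset[OF _ fin[OF that]]) (auto simp: M_def)
  have unique: "y = y'" if "x \<in> V" "(x, y) \<in> M" "(x, y') \<in> M" for x y y'
  proof (rule ccontr)
    assume "y \<noteq> y'"
    then have "hall_condition V (M - {(x, y)}) \<or> hall_condition V (M - {(x, y')})"
      using hall_condition_delete_edge[OF finM hallM that(1) _ that(2,3)] by simp
    then obtain z where z: "(x, z) \<in> M" "hall_condition V (M - {(x, z)})"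
      using \<open>(x, y) \<in> M\<close> \<open>(x, y') \<in> M\<close> by auto
    have "M - {(x, z)} = E - insert (x, z) D" by (auto simp: M_def)
    then have "insert (x, z) D = D" using D z by auto
    then show False using z by (auto simp: M_def)
  qed
  have "\<exists>y. (x, y) \<in> M" if "x \<in> V" for x
  proof -
    have "card {x} \<le> card (M `` {x})"
      using hallM that unfolding hall_condition_def by blast
    then have "M `` {x} \<noteq> {}" by auto
    then show ?thesis by blast
  qed
  then obtain \<phi> where \<phi>: "\<And>x. x \<in> V \<Longrightarrow> (x, \<phi> x) \<in> M" by metis
  have "inj_on \<phi> V"
  proof (rule inj_onI, rule ccontr)
    fix x x' assume x: "x \<in> V" "x' \<in> V" "\<phi> x = \<phi> x'" "x \<noteq> x'"
    have "y = \<phi> x" if "y \<in> M `` {x, x'}" for y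
      using that unique[OF x(1) _ \<phi>] unique[OF x(2) _ \<phi>] x(1-3) by auto
    then have "M `` {x, x'} \<subseteq> {\<phi> x}" by blast
    then have "card (M `` {x, x'}) \<le> 1" using card_mono[of "{\<phi> x}"] by fastforce
    moreover have "card {x, x'} \<le> card (M `` {x, x'})"
      using hallM[unfolded hall_condition_def, rule_format, of "{x, x'}"] x by simp
    ultimately show False using x by simp
  qed
  then show ?thesis using \<phi> by (auto simp: M_def)
qed

section \<open>Small expansion in amenable groups\<close>

lemma finitely_additive_UN_disjoint:
  fixes \<mu> :: "'g set \<Rightarrow> real"
  assumes add: "\<And>A B. A \<subseteq> \<Omega> \<Longrightarrow> B \<subseteq> \<Omega> \<Longrightarrow> A \<inter> B = {} \<Longrightarrow> \<mu> (A \<union> B) = \<mu> A + \<mu> B"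
    and "finite I" "\<And>i. i \<in> I \<Longrightarrow> A i \<subseteq> \<Omega>" "disjoint_family_on A I"
  shows "\<mu> (\<Union>i\<in>I. A i) = (\<Sum>i\<in>I. \<mu> (A i))"
  using assms(2-)
proof (induction I rule: finite_induct)
  case empty
  show ?case using add[of "{}" "{}"] by simp
next
  case (insert i I)
  have "A i \<inter> (\<Union>i\<in>I. A i) = {}"
    using insert by (auto simp: disjoint_family_on_def)
  moreover have "\<mu> (\<Union>i\<in>I. A i) = (\<Sum>i\<in>I. \<mu> (A i))"
    using insert by (intro insert.IH) (auto simp: disjoint_family_on_def)
  ultimately show ?case using insert add[of "A i" "\<Union>i\<in>I. A i"] by (simp add: UN_subset_iff)
qed

text \<open>
  Let \<open>P i f j\<close> be the set of those \<open>g\<close> for which \<open>\<phi>\<close> moves \<open>g\<close> from copy \<open>i\<close> to copy \<open>j\<close> by the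
  translation with \<open>f\<close>.  For fixed \<open>i\<close> these sets partition \<open>G\<close>, so their means add up to \<open>1\<close>.
  For fixed \<open>j\<close> their translates by \<open>f\<close> are disjoint, so their means add up to at most \<open>1\<close>.
  Summing over all \<open>i\<close>, \<open>f\<close> and \<open>j\<close> gives \<open>l \<le> k\<close>.
\<close>

lemma amenable_no_paradoxical_injection:
  assumes "amenable G" and F: "finite F" "F \<subseteq> carrier G"
    and inj: "inj_on \<phi> (carrier G \<times> {..<l})"
    and near: "\<And>g i. g \<in> carrier G \<Longrightarrow> i < l \<Longrightarrow>
      \<exists>f\<in>F. \<exists>j<k. \<phi> (g, i) = (f \<otimes>\<^bsub>G\<^esub> g, j)"
  shows "l \<le> (k :: nat)"
proof -
  from \<open>amenable G\<close> interpret group G by (simp add: amenable_def)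
  from \<open>amenable G\<close> obtain \<mu> :: "'a set \<Rightarrow> real" where
    nonneg: "\<forall>A. A \<subseteq> carrier G \<longrightarrow> 0 \<le> \<mu> A" and one: "\<mu> (carrier G) = 1"
    and additive: "\<forall>A B. A \<subseteq> carrier G \<longrightarrow> B \<subseteq> carrier G \<longrightarrow> A \<inter> B = {} \<longrightarrow>
      \<mu> (A \<union> B) = \<mu> A + \<mu> B"
    and invar: "\<forall>g A. g \<in> carrier G \<longrightarrow> A \<subseteq> carrier G \<longrightarrow> \<mu> (g <#\<^bsub>G\<^esub> A) = \<mu> A"
    unfolding amenable_def by (elim conjE exE) (rule that)
  have add: "\<mu> (A \<union> B) = \<mu> A + \<mu> B"
    if "A \<subseteq> carrier G" "B \<subseteq> carrier G" "A \<inter> B = {}" for A B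
    using additive that by blast
  define P where "P i f j = {g \<in> carrier G. \<phi> (g, i) = (f \<otimes>\<^bsub>G\<^esub> g, j)}" for i :: nat and f and j :: nat
  have P: "P i f j \<subseteq> carrier G" for i f j by (auto simp: P_def)
  have rows: "(\<Sum>(f, j)\<in>F \<times> {..<k}. \<mu> (P i f j)) = 1" if "i < l" for i
  proof -
    have "(\<Union>(f, j)\<in>F \<times> {..<k}. P i f j) = carrier G"
      using near[OF _ that] P by (fastforce simp: P_def)
    moreover have "disjoint_family_on (\<lambda>(f, j). P i f j) (F \<times> {..<k})"
      using F by (auto simp: disjoint_family_on_def P_def subset_iff)
    ultimately show ?thesis
      using finitely_additive_UN_disjoint[of "carrier G" \<mu> "F \<times> {..<k}" "\<lambda>(f, j). P i f j"]
        add P F one by (auto simp: split_def)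
  qed
  have cols: "(\<Sum>(i, f)\<in>{..<l} \<times> F. \<mu> (P i f j)) \<le> 1" for j
  proof -
    let ?Q = "\<lambda>(i, f). f <#\<^bsub>G\<^esub> P i f j"
    have Q: "?Q p \<subseteq> carrier G" if "p \<in> {..<l} \<times> F" for p
      using that F P by (auto simp: l_coset_def subset_iff)
    have "disjoint_family_on ?Q ({..<l} \<times> F)"
      unfolding disjoint_family_on_def
    proof (intro ballI impI equals0I)
      fix p q z assume "p \<in> {..<l} \<times> F" "q \<in> {..<l} \<times> F" and ne: "p \<noteq> q"
        and z: "z \<in> ?Q p \<inter> ?Q q"
      then obtain i f i' f' where pq: "p = (i, f)" "q = (i', f')"
        and *: "i < l" "f \<in> F" "i' < l" "f' \<in> F" by auto
      obtain g g' where g: "g \<in> P i f j" "g' \<in> P i' f' j" "f \<otimes>\<^bsub>G\<^esub> g = f' \<otimes>\<^bsub>G\<^esub> g'"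
        using z pq by (auto simp: l_coset_def)
      then have "\<phi> (g, i) = \<phi> (g', i')" by (simp add: P_def)
      then have eq: "g = g'" "i = i'" using inj * g by (auto simp: inj_on_def P_def)
      then have "f = f'" using g * F P by (auto simp: P_def subset_iff)
      with eq ne pq show False by simp
    qed
    then have "\<mu> (\<Union>p\<in>{..<l} \<times> F. ?Q p) = (\<Sum>p\<in>{..<l} \<times> F. \<mu> (?Q p))"
      using F Q add by (intro finitely_additive_UN_disjoint[of "carrier G"]) auto
    also have "\<dots> = (\<Sum>(i, f)\<in>{..<l} \<times> F. \<mu> (P i f j))"
      using F P by (intro sum.cong) (auto simp: invar subset_iff)
    finally have sum: "(\<Sum>(i, f)\<in>{..<l} \<times> F. \<mu> (P i f j)) = \<mu> (\<Union>p\<in>{..<l} \<times> F. ?Q p)" ..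
    define U where "U = (\<Union>p\<in>{..<l} \<times> F. ?Q p)"
    have "U \<subseteq> carrier G" using Q unfolding U_def by blast
    then have "\<mu> U \<le> 1"
      using add[of U "carrier G - U"] nonneg[rule_format, of "carrier G - U"] one
      by (simp add: Diff_partition Un_absorb1)
    then show ?thesis using sum by (simp add: U_def)
  qed
  have "real l = (\<Sum>i<l. \<Sum>(f, j)\<in>F \<times> {..<k}. \<mu> (P i f j))" using rows by simp
  also have "\<dots> = (\<Sum>i<l. \<Sum>f\<in>F. \<Sum>j<k. \<mu> (P i f j))"
    by (simp add: sum.cartesian_product)
  also have "\<dots> = (\<Sum>i<l. \<Sum>j<k. \<Sum>f\<in>F. \<mu> (P i f j))"
    by (intro sum.cong refl sum.swap)
  also have "\<dots> = (\<Sum>j<k. \<Sum>i<l. \<Sum>f\<in>F. \<mu> (P i f j))"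
    by (rule sum.swap)
  also have "\<dots> = (\<Sum>j<k. \<Sum>(i, f)\<in>{..<l} \<times> F. \<mu> (P i f j))"
    by (simp add: sum.cartesian_product)
  also have "\<dots> \<le> (\<Sum>j<k. 1)" by (intro sum_mono cols)
  finally show ?thesis by simp
qed

text \<open>
  This is Foelner's condition in the form of a bound on growth: for \<open>k > 0\<close> the ratio \<open>|F K| / |K|\<close>
  is below \<open>l / k\<close>, which may be as close to \<open>1\<close> as desired.
\<close>

theorem amenable_small_expansion:
  assumes am: "amenable G" and F: "finite F" "F \<subseteq> carrier G" and kl: "k < (l :: nat)"
  obtains V where "finite V" "V \<subseteq> carrier G" "k * card (F <#>\<^bsub>G\<^esub> V) < l * card V"
proof (rule ccontr)
  assume "\<not> thesis"
  with that have big: "l * card V \<le> k * card (F <#>\<^bsub>G\<^esub> V)"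
    if "finite V" "V \<subseteq> carrier G" for V using that by (meson not_le)
  define E where
    "E = {((g, i), (f \<otimes>\<^bsub>G\<^esub> g, j)) | g i f j. g \<in> carrier G \<and> i < l \<and> f \<in> F \<and> j < k}"
  have "hall_condition (carrier G \<times> {..<l}) E"
    unfolding hall_condition_def
  proof (intro allI impI)
    fix S assume S: "finite S" "S \<subseteq> carrier G \<times> {..<l}"
    have "S \<subseteq> fst ` S \<times> {..<l}" using S by force
    then have "card S \<le> l * card (fst ` S)"
      using S card_mono[of "fst ` S \<times> {..<l}" S] by (simp add: card_cartesian_product mult.commute)
    also have "\<dots> \<le> k * card (F <#>\<^bsub>G\<^esub> fst ` S)"
      using S by (intro big) auto
    also have "\<dots> = card ((F <#>\<^bsub>G\<^esub> fst ` S) \<times> {..<k})"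
      by (simp add: card_cartesian_product mult.commute)
    also have "(F <#>\<^bsub>G\<^esub> fst ` S) \<times> {..<k} = E `` S"
    proof
      show "(F <#>\<^bsub>G\<^esub> fst ` S) \<times> {..<k} \<subseteq> E `` S"
        using S by (force simp: E_def set_mult_def)
      show "E `` S \<subseteq> (F <#>\<^bsub>G\<^esub> fst ` S) \<times> {..<k}"
        using S by (force simp: E_def set_mult_def)
    qed
    finally show "card S \<le> card (E `` S)" .
  qed
  moreover have "finite (E `` {x})" for x
  proof (rule finite_subset)
    show "E `` {x} \<subseteq> (\<lambda>f. f \<otimes>\<^bsub>G\<^esub> fst x) ` F \<times> {..<k}" by (auto simp: E_def)
  qed (use F in auto)
  ultimately obtain \<phi> where inj: "inj_on \<phi> (carrier G \<times> {..<l})"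
    and \<phi>: "\<And>x. x \<in> carrier G \<times> {..<l} \<Longrightarrow> (x, \<phi> x) \<in> E"
    using hall_marriage by metis
  have "l \<le> k"
  proof (rule amenable_no_paradoxical_injection[OF am F inj])
    fix g i assume "g \<in> carrier G" "i < l"
    then show "\<exists>f\<in>F. \<exists>j<k. \<phi> (g, i) = (f \<otimes>\<^bsub>G\<^esub> g, j)"
      using \<phi>[of "(g, i)"] by (auto simp: E_def)
  qed
  with kl show False by simp
qed

section \<open>Finite sums in abelian monoids\<close>

lemma (in abelian_monoid) finsum_finsum_swap:
  assumes "finite S" "finite T" "\<And>s t. s \<in> S \<Longrightarrow> t \<in> T \<Longrightarrow> f s t \<in> carrier G"
  shows "(\<Oplus>s\<in>S. \<Oplus>t\<in>T. f s t) = (\<Oplus>t\<in>T. \<Oplus>s\<in>S. f s t)"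
  using assms(1,3)
proof (induction S rule: finite_induct)
  case (insert s S)
  then have "(\<Oplus>s\<in>insert s S. \<Oplus>t\<in>T. f s t) = (\<Oplus>t\<in>T. f s t) \<oplus> (\<Oplus>t\<in>T. \<Oplus>s\<in>S. f s t)"
    by (subst finsum_insert) (auto intro!: finsum_closed)
  also have "\<dots> = (\<Oplus>t\<in>T. f s t \<oplus> (\<Oplus>s\<in>S. f s t))"
    using insert by (intro finsum_addf[symmetric]) (auto intro!: finsum_closed)
  also have "\<dots> = (\<Oplus>t\<in>T. \<Oplus>s\<in>insert s S. f s t)"
    using insert by (intro finsum_cong') (auto intro!: finsum_closed simp: Pi_iff)
  finally show ?case .
qed (simp add: finsum_zero)

lemma (in abelian_monoid) finsum_Times:
  assumes "finite S" "finite T" "\<And>s t. s \<in> S \<Longrightarrow> t \<in> T \<Longrightarrow> f (s, t) \<in> carrier G"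
  shows "(\<Oplus>p\<in>S \<times> T. f p) = (\<Oplus>s\<in>S. \<Oplus>t\<in>T. f (s, t))"
  using assms(1,3)
proof (induction S rule: finite_induct)
  case (insert s S)
  have "(\<Oplus>p\<in>insert s S \<times> T. f p) = (\<Oplus>p\<in>Pair s ` T \<union> S \<times> T. f p)"
    by (rule arg_cong[of _ _ "finsum G f"]) auto
  also have "\<dots> = (\<Oplus>p\<in>Pair s ` T. f p) \<oplus> (\<Oplus>p\<in>S \<times> T. f p)"
    using insert assms(2) by (intro finsum_Un_disjoint) auto
  also have "(\<Oplus>p\<in>Pair s ` T. f p) = (\<Oplus>t\<in>T. f (s, t))"
    using insert by (intro finsum_reindex) (auto simp: inj_on_def)
  also have "(\<Oplus>t\<in>T. f (s, t)) \<oplus> (\<Oplus>p\<in>S \<times> T. f p) = (\<Oplus>s\<in>insert s S. \<Oplus>t\<in>T. f (s, t))"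
    using insert by (subst finsum_insert) (auto intro!: finsum_closed)
  finally show ?case .
qed simp

section \<open>The strong rank condition as solvability of linear systems\<close>

text \<open>
  The coefficients stand on the left of the unknowns, so that the solutions form a right submodule
  of \<open>R\<^sup>n\<^sup>+\<^sup>1\<close>.
\<close>

definition underdetermined_solvable :: "('a, 'm) ring_scheme \<Rightarrow> bool" where
  "underdetermined_solvable R \<longleftrightarrow>
    (\<forall>(n :: nat) m. (\<forall>j<n. \<forall>i\<le>n. m j i \<in> carrier R) \<longrightarrow>
      (\<exists>x. (\<forall>i\<le>n. x i \<in> carrier R) \<and> (\<exists>i\<le>n. x i \<noteq> \<zero>\<^bsub>R\<^esub>) \<and>
        (\<forall>j<n. (\<Oplus>\<^bsub>R\<^esub>i\<in>{..n}. m j i \<otimes>\<^bsub>R\<^esub> x i) = \<zero>\<^bsub>R\<^esub>)))"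

text \<open>
  Surplus unknowns are set to zero, so an excess of exactly one unknown is enough, and the
  index sets may be arbitrary.
\<close>

lemma (in ring) underdetermined_solvableD:
  assumes solv: "underdetermined_solvable R"
    and I: "finite I" and J: "finite J" and less: "card J < card I"
    and m: "\<And>j i. j \<in> J \<Longrightarrow> i \<in> I \<Longrightarrow> m j i \<in> carrier R"
  obtains x where "\<And>i. i \<in> I \<Longrightarrow> x i \<in> carrier R" "\<exists>i\<in>I. x i \<noteq> \<zero>"
    "\<And>j. j \<in> J \<Longrightarrow> (\<Oplus>i\<in>I. m j i \<otimes> x i) = \<zero>"
proof -
  define n where "n = card J"
  obtain q where q: "bij_betw q {..<n} J"
    using ex_bij_betw_nat_finite[OF J] by (auto simp: n_def atLeast0LessThan)
  obtain I' where I': "I' \<subseteq> I" "card I' = Suc n"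
    using less by (metis Suc_leI n_def obtain_subset_with_card_n)
  then have finI': "finite I'" using I finite_subset by blast
  obtain p where p: "bij_betw p {..n} I'"
    using ex_bij_betw_nat_finite[OF finI'] I' by (auto simp: atLeast0LessThan lessThan_Suc_atMost)
  have pI: "p k \<in> I" if "k \<le> n" for k using p I' that by (auto simp: bij_betw_def)
  have qJ: "q k \<in> J" if "k < n" for k using q that by (auto simp: bij_betw_def)
  obtain y where y: "\<forall>k\<le>n. y k \<in> carrier R" "\<exists>k\<le>n. y k \<noteq> \<zero>"
    "\<forall>j<n. (\<Oplus>k\<in>{..n}. m (q j) (p k) \<otimes> y k) = \<zero>"
    using solv[unfolded underdetermined_solvable_def, rule_format, of n "\<lambda>j k. m (q j) (p k)"]
      m pI qJ by blast
  define x where "x i = (if i \<in> I' then y (the_inv_into {..n} p i) else \<zero>)" for i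
  have xp: "x (p k) = y k" if "k \<le> n" for k
    using p that by (auto simp: x_def bij_betw_def the_inv_into_f_f)
  have xI: "x i \<in> carrier R" for i
  proof (cases "i \<in> I'")
    case True
    then obtain k where "k \<le> n" "i = p k" using p by (auto simp: bij_betw_def)
    then show ?thesis using xp y by simp
  qed (simp add: x_def)
  show thesis
  proof (rule that)
    show "\<exists>i\<in>I. x i \<noteq> \<zero>" using y xp pI by metis
    fix j assume "j \<in> J"
    then obtain k where k: "k < n" "j = q k" using q by (auto simp: bij_betw_def)
    have "(\<Oplus>i\<in>I. m j i \<otimes> x i) = (\<Oplus>i\<in>I'. m j i \<otimes> x i)"
      using I I' m[OF \<open>j \<in> J\<close>] xI
      by (intro add.finprod_mono_neutral_cong_right[folded finsum_def]) (auto simp: x_def)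
    also have "I' = p ` {..n}" using p by (simp add: bij_betw_def)
    also have "(\<Oplus>i\<in>p ` {..n}. m j i \<otimes> x i) = (\<Oplus>l\<in>{..n}. m j (p l) \<otimes> x (p l))"
      using p pI m[OF \<open>j \<in> J\<close>] xI
      by (intro finsum_reindex) (auto simp: bij_betw_def)
    also have "\<dots> = (\<Oplus>l\<in>{..n}. m j (p l) \<otimes> y l)"
      using pI m[OF \<open>j \<in> J\<close>] y by (intro finsum_cong') (auto simp: xp)
    finally show "(\<Oplus>i\<in>I. m j i \<otimes> x i) = \<zero>" using y k by simp
  qed (rule xI)
qed

lemma free_add_group_simps:
  "carrier (free_add_group R n) = (\<Pi>\<^sub>E i\<in>{..<n}. carrier R)"
  "x \<otimes>\<^bsub>free_add_group R n\<^esub> y = (\<lambda>i\<in>{..<n}. x i \<oplus>\<^bsub>R\<^esub> y i)"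
  by (simp_all add: free_add_group_def)

text \<open>
  The left-hand sides of the equations form a homomorphism of right modules from \<open>R\<^sup>n\<^sup>+\<^sup>1\<close> to \<open>R\<^sup>n\<close>.
  It is not injective, and a nonzero element of its kernel solves the system.
\<close>

lemma (in ring) SRC_imp_underdetermined_solvable:
  assumes "SRC R"
  shows "underdetermined_solvable R"
  unfolding underdetermined_solvable_def
proof (intro allI impI)
  fix n :: nat and m assume m: "\<forall>j<n. \<forall>i\<le>n. m j i \<in> carrier R"
  define f where "f x = (\<lambda>j\<in>{..<n}. \<Oplus>i\<in>{..n}. m j i \<otimes> x i)" for x
  have carr: "x i \<in> carrier R" if "x \<in> carrier (free_add_group R (n + 1))" "i \<le> n" for x i
    using that by (auto simp: free_add_group_simps PiE_def Pi_def)
  have f_add: "f (x \<otimes>\<^bsub>free_add_group R (n + 1)\<^esub> y) = f x \<otimes>\<^bsub>free_add_group R n\<^esub> f y"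
    if "x \<in> carrier (free_add_group R (n + 1))" "y \<in> carrier (free_add_group R (n + 1))" for x y
  proof -
    have "(\<Oplus>i\<in>{..n}. m j i \<otimes> (x i \<oplus> y i)) = (\<Oplus>i\<in>{..n}. m j i \<otimes> x i) \<oplus> (\<Oplus>i\<in>{..n}. m j i \<otimes> y i)"
      if "j < n" for j
    proof -
      have "(\<Oplus>i\<in>{..n}. m j i \<otimes> (x i \<oplus> y i)) = (\<Oplus>i\<in>{..n}. m j i \<otimes> x i \<oplus> m j i \<otimes> y i)"
        using m that carr \<open>x \<in> _\<close> \<open>y \<in> _\<close> by (intro finsum_cong') (auto simp: r_distr)
      also have "\<dots> = (\<Oplus>i\<in>{..n}. m j i \<otimes> x i) \<oplus> (\<Oplus>i\<in>{..n}. m j i \<otimes> y i)"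
        using m that carr \<open>x \<in> _\<close> \<open>y \<in> _\<close> by (intro finsum_addf) auto
      finally show ?thesis .
    qed
    moreover have "(\<Oplus>i\<in>{..n}. m j i \<otimes> (x \<otimes>\<^bsub>free_add_group R (n + 1)\<^esub> y) i)
        = (\<Oplus>i\<in>{..n}. m j i \<otimes> (x i \<oplus> y i))" if "j < n" for j
      using m that carr \<open>x \<in> _\<close> \<open>y \<in> _\<close>
      by (intro finsum_cong') (auto simp: free_add_group_simps)
    ultimately show ?thesis
      unfolding f_def free_add_group_simps(2)[of _ n] by (intro restrict_ext) simp
  qed
  have f_smult: "f (right_smult R (n + 1) x r) = right_smult R n (f x) r"
    if "x \<in> carrier (free_add_group R (n + 1))" "r \<in> carrier R" for x r
  proof -
    have "(\<Oplus>i\<in>{..n}. m j i \<otimes> (right_smult R (n + 1) x r) i) = (\<Oplus>i\<in>{..n}. m j i \<otimes> x i) \<otimes> r"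
      if "j < n" for j
    proof -
      have "(\<Oplus>i\<in>{..n}. m j i \<otimes> (right_smult R (n + 1) x r) i) = (\<Oplus>i\<in>{..n}. m j i \<otimes> x i \<otimes> r)"
        using m that carr \<open>x \<in> _\<close> \<open>r \<in> _\<close>
        by (intro finsum_cong') (auto simp: right_smult_def m_assoc)
      also have "\<dots> = (\<Oplus>i\<in>{..n}. m j i \<otimes> x i) \<otimes> r"
        using m that carr \<open>x \<in> _\<close> \<open>r \<in> _\<close> by (intro finsum_ldistr[symmetric]) auto
      finally show ?thesis .
    qed
    then show ?thesis unfolding f_def right_smult_def[of R n] by (intro restrict_ext) simp
  qed
  have f_carr: "f x \<in> carrier (free_add_group R n)"
    if "x \<in> carrier (free_add_group R (n + 1))" for x
    unfolding f_def free_add_group_simps using m carr[OF that] by (auto intro!: finsum_closed)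
  have "f \<notin> right_module_monos R (n + 1) n"
    using assms by (simp add: SRC_def)
  then have "\<not> inj_on f (carrier (free_add_group R (n + 1)))"
    using f_add f_smult f_carr by (auto simp: right_module_monos_def mon_def hom_def)
  then obtain x y where xy: "x \<in> carrier (free_add_group R (n + 1))"
    "y \<in> carrier (free_add_group R (n + 1))" "f x = f y" "x \<noteq> y"
    by (auto simp: inj_on_def)
  have "\<exists>i\<le>n. x i \<noteq> y i"
  proof (rule ccontr)
    assume "\<not> ?thesis"
    then have "x = y"
      using xy(1,2) unfolding free_add_group_simps by (intro PiE_ext[of x _ _ y]) auto
    with xy show False by simp
  qed
  then obtain i where i: "i \<le> n" "x i \<noteq> y i" by blast
  show "\<exists>x. (\<forall>i\<le>n. x i \<in> carrier R) \<and> (\<exists>i\<le>n. x i \<noteq> \<zero>) \<and>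
      (\<forall>j<n. (\<Oplus>i\<in>{..n}. m j i \<otimes> x i) = \<zero>)"
  proof (intro exI conjI allI impI)
    show "i \<le> n" by fact
    show "x i \<ominus> y i \<noteq> \<zero>"
      using i carr xy by (simp add: r_right_minus_eq)
    fix j assume j: "j < n"
    have "(\<Oplus>i\<in>{..n}. m j i \<otimes> y i) = (\<Oplus>i\<in>{..n}. m j i \<otimes> x i)"
      using fun_cong[OF xy(3), of j] j by (simp add: f_def)
    also have "(\<Oplus>i\<in>{..n}. m j i \<otimes> x i)
        = (\<Oplus>i\<in>{..n}. m j i \<otimes> (x i \<ominus> y i) \<oplus> m j i \<otimes> y i)"
    proof (intro finsum_cong')
      fix i assume "i \<in> {..n}"
      then have "x i \<in> carrier R" "y i \<in> carrier R" "m j i \<in> carrier R"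
        using carr xy m j by auto
      then show "m j i \<otimes> x i = m j i \<otimes> (x i \<ominus> y i) \<oplus> m j i \<otimes> y i"
        by (simp add: r_distr[symmetric] minus_eq a_assoc l_neg)
    qed (use carr xy m j in auto)
    also have "\<dots> = (\<Oplus>i\<in>{..n}. m j i \<otimes> (x i \<ominus> y i)) \<oplus> (\<Oplus>i\<in>{..n}. m j i \<otimes> y i)"
      using carr xy m j by (intro finsum_addf) auto
    finally have eq: "(\<Oplus>i\<in>{..n}. m j i \<otimes> y i) = \<dots>" .
    have "(\<Oplus>i\<in>{..n}. m j i \<otimes> (x i \<ominus> y i)) \<in> carrier R"
      "(\<Oplus>i\<in>{..n}. m j i \<otimes> y i) \<in> carrier R"
      using carr xy m j by (auto intro!: finsum_closed)
    then show "(\<Oplus>i\<in>{..n}. m j i \<otimes> (x i \<ominus> y i)) = \<zero>"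
      using eq add.r_cancel_one' by blast
  qed (use carr xy in auto)
qed

text \<open>
  A homomorphism of right modules is given by the matrix with columns \<open>f (e i)\<close>, the images of the
  standard basis.  A nonzero solution of the system with this matrix is a nonzero element of the
  kernel of \<open>f\<close>.
\<close>

lemma (in ring) underdetermined_solvable_imp_SRC:
  assumes solv: "underdetermined_solvable R"
  shows "SRC R"
  unfolding SRC_def
proof (intro allI notI, elim exE)
  fix n f assume f: "f \<in> right_module_monos R (n + 1) n"
  let ?V = "free_add_group R (n + 1)" and ?W = "free_add_group R n"
  have f_hom: "f x \<in> carrier ?W" "f (x \<otimes>\<^bsub>?V\<^esub> y) = f x \<otimes>\<^bsub>?W\<^esub> f y"
    if "x \<in> carrier ?V" "y \<in> carrier ?V" for x y
    using f that by (auto simp: right_module_monos_def mon_def hom_def)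
  have f_coord: "f x j \<in> carrier R" if "x \<in> carrier ?V" "j < n" for x j
    using f_hom(1)[OF that(1) that(1)] that(2) by (auto simp: free_add_group_simps)
  have f_inj: "inj_on f (carrier ?V)"
    using f by (simp add: right_module_monos_def mon_def)
  have f_smult: "f (right_smult R (n + 1) x r) = right_smult R n (f x) r"
    if "x \<in> carrier ?V" "r \<in> carrier R" for x r
    using f that by (simp add: right_module_monos_def)
  define e where "e k = (\<lambda>i\<in>{..<n + 1}. if i = k then \<one> else \<zero>)" for k
  have e: "e k \<in> carrier ?V" for k by (auto simp: e_def free_add_group_simps)
  obtain x where x: "\<forall>i\<le>n. x i \<in> carrier R" "\<exists>i\<le>n. x i \<noteq> \<zero>"
    "\<forall>j<n. (\<Oplus>i\<in>{..n}. f (e i) j \<otimes> x i) = \<zero>"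
    using solv[unfolded underdetermined_solvable_def, rule_format, of n "\<lambda>j i. f (e i) j"]
      f_coord[OF e] by blast
  \<comment> \<open>The truncations \<open>t k\<close> of \<open>x\<close> allow an expansion of \<open>f\<close> along the standard basis by
    induction on \<open>k\<close>.\<close>
  define t where "t k = (\<lambda>i\<in>{..<n + 1}. if i < k then x i else \<zero>)" for k
  have t: "t k \<in> carrier ?V" for k using x by (auto simp: t_def free_add_group_simps)
  have f_zero: "f (t 0) j = \<zero>" if "j < n" for j
  proof -
    have "t 0 = t 0 \<otimes>\<^bsub>?V\<^esub> t 0" by (auto simp: t_def free_add_group_simps)
    then have "f (t 0) = f (t 0) \<otimes>\<^bsub>?W\<^esub> f (t 0)" using f_hom(2)[OF t t] by metis
    then have "f (t 0) j = f (t 0) j \<oplus> f (t 0) j"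
      using that by (metis (lifting) free_add_group_simps(2) lessThan_iff restrict_apply')
    then show ?thesis using f_coord[OF t that] by (metis add.l_cancel_one')
  qed
  have expand: "f (t k) j = (\<Oplus>i\<in>{..<k}. f (e i) j \<otimes> x i)" if "k \<le> n + 1" "j < n" for k j
    using that(1)
  proof (induction k)
    case 0
    then show ?case using f_zero that by simp
  next
    case (Suc k)
    then have xk: "x k \<in> carrier R" using x by simp
    have "right_smult R (n + 1) (e k) (x k) \<in> carrier ?V"
      using xk by (auto simp: right_smult_def e_def free_add_group_simps)
    moreover have "t (Suc k) = right_smult R (n + 1) (e k) (x k) \<otimes>\<^bsub>?V\<^esub> t k"
      using x Suc.prems
      by (auto simp: t_def e_def right_smult_def free_add_group_simps restrict_def fun_eq_iff less_Suc_eq)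
    ultimately have "f (t (Suc k)) = right_smult R n (f (e k)) (x k) \<otimes>\<^bsub>?W\<^esub> f (t k)"
      using f_hom(2)[OF _ t] f_smult[OF e xk] by simp
    then have "f (t (Suc k)) j = f (e k) j \<otimes> x k \<oplus> f (t k) j"
      using that by (simp add: right_smult_def free_add_group_simps)
    then show ?case
      using Suc xk x f_coord[OF e \<open>j < n\<close>] by (simp add: lessThan_Suc Pi_iff)
  qed
  have "f (t (n + 1)) j = f (t 0) j" if "j < n" for j
    using expand[of "n + 1" j] x(3) f_zero that by (simp add: lessThan_Suc_atMost)
  then have "f (t (n + 1)) = f (t 0)"
    using f_hom(1)[OF t t] unfolding free_add_group_simps
    by (intro PiE_ext[of _ "{..<n}" "\<lambda>_. carrier R"]) auto
  then have "t (n + 1) = t 0" using f_inj t by (simp add: inj_on_def)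
  moreover obtain i where "i \<le> n" "x i \<noteq> \<zero>" using x by blast
  ultimately show False
    by (auto simp: t_def fun_eq_iff split: if_splits dest!: spec[of _ i])
qed

section \<open>Homogeneous components and the base ring\<close>

lemma (in ring) finsum_subring:
  assumes "subring H R" "finite S" "\<And>s. s \<in> S \<Longrightarrow> f s \<in> H"
  shows "finsum (R\<lparr>carrier := H\<rparr>) f S = finsum R f S"
proof -
  interpret H: ring "R\<lparr>carrier := H\<rparr>" using assms(1) by (rule subring_is_ring)
  have sub: "H \<subseteq> carrier R" using subringE(1)[OF assms(1)] .
  from assms(2,3) show ?thesis
  proof (induction S rule: finite_induct)
    case (insert s S)
    then have "f \<in> S \<rightarrow> H" by auto
    with insert sub show ?case by (simp add: Pi_iff subset_iff)
  qed simp
qed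

context graded_ring
begin

lemma component_subset: "g \<in> carrier G \<Longrightarrow> A g \<subseteq> carrier R"
  using component_additive_subgroup by (rule additive_subgroup.a_subset)

lemma component_zero: "g \<in> carrier G \<Longrightarrow> \<zero>\<^bsub>R\<^esub> \<in> A g"
  using component_additive_subgroup by (rule additive_subgroup.zero_closed)

lemma component_add: "g \<in> carrier G \<Longrightarrow> a \<in> A g \<Longrightarrow> b \<in> A g \<Longrightarrow> a \<oplus>\<^bsub>R\<^esub> b \<in> A g"
  using component_additive_subgroup by (rule additive_subgroup.a_closed)

lemma component_minus: "g \<in> carrier G \<Longrightarrow> a \<in> A g \<Longrightarrow> \<ominus>\<^bsub>R\<^esub> a \<in> A g"
  using additive_subgroup.a_subgroup[OF component_additive_subgroup]
  by (simp add: a_inv_def subgroup.m_inv_closed)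

definition homogeneous_part :: "'a \<Rightarrow> 'g \<Rightarrow> 'a" where
  "homogeneous_part r = (THE x. x \<in> (\<Pi>\<^sub>E g\<in>carrier G. A g) \<and> finite (grade_support G R x) \<and>
    r = (\<Oplus>\<^bsub>R\<^esub>g\<in>grade_support G R x. x g))"

lemma homogeneous_part:
  assumes "r \<in> carrier R"
  shows homogeneous_part_in: "g \<in> carrier G \<Longrightarrow> homogeneous_part r g \<in> A g"
    and homogeneous_part_carrier: "g \<in> carrier G \<Longrightarrow> homogeneous_part r g \<in> carrier R"
    and homogeneous_part_finite: "finite (grade_support G R (homogeneous_part r))"
    and homogeneous_part_sum: "finite S \<Longrightarrow> S \<subseteq> carrier G \<Longrightarrow>
      grade_support G R (homogeneous_part r) \<subseteq> S \<Longrightarrow> (\<Oplus>\<^bsub>R\<^esub>g\<in>S. homogeneous_part r g) = r"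
proof -
  let ?c = "homogeneous_part r"
  have c: "?c \<in> (\<Pi>\<^sub>E g\<in>carrier G. A g) \<and> finite (grade_support G R ?c) \<and>
      r = (\<Oplus>\<^bsub>R\<^esub>g\<in>grade_support G R ?c. ?c g)"
    unfolding homogeneous_part_def by (rule theI'[OF unique_decomposition[OF assms]])
  then show "finite (grade_support G R ?c)" by blast
  show cA: "?c g \<in> A g" if "g \<in> carrier G" for g using c that by auto
  then show cR: "?c g \<in> carrier R" if "g \<in> carrier G" for g
    using that component_subset[OF that] by blast
  assume S: "finite S" "S \<subseteq> carrier G" "grade_support G R ?c \<subseteq> S"
  then have "(\<Oplus>\<^bsub>R\<^esub>g\<in>S. ?c g) = (\<Oplus>\<^bsub>R\<^esub>g\<in>grade_support G R ?c. ?c g)"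
    using cR by (intro R.add.finprod_mono_neutral_cong_right[folded finsum_def])
      (auto simp: grade_support_def)
  then show "(\<Oplus>\<^bsub>R\<^esub>g\<in>S. ?c g) = r" using c by simp
qed

text \<open>
  The family \<open>a\<close>, extended by zero, and the zero family are both decompositions of \<open>\<zero>\<close>.
\<close>

lemma homogeneous_independent:
  assumes K: "finite K" "K \<subseteq> carrier G" and a: "\<And>g. g \<in> K \<Longrightarrow> a g \<in> A g"
    and sum: "(\<Oplus>\<^bsub>R\<^esub>g\<in>K. a g) = \<zero>\<^bsub>R\<^esub>" and g: "g \<in> K"
  shows "a g = \<zero>\<^bsub>R\<^esub>"
proof -
  define x where "x = (\<lambda>g\<in>carrier G. if g \<in> K then a g else \<zero>\<^bsub>R\<^esub>)"
  define z where "z = (\<lambda>g\<in>carrier G. \<zero>\<^bsub>R\<^esub>)"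
  have supp: "grade_support G R x \<subseteq> K" by (auto simp: grade_support_def x_def)
  have "(\<Oplus>\<^bsub>R\<^esub>g\<in>grade_support G R x. x g) = (\<Oplus>\<^bsub>R\<^esub>g\<in>K. a g)"
    using K a component_subset
    by (intro R.add.finprod_mono_neutral_cong_left[folded finsum_def])
      (auto simp: x_def grade_support_def split: if_splits)
  then have "x \<in> (\<Pi>\<^sub>E g\<in>carrier G. A g) \<and> finite (grade_support G R x) \<and>
      \<zero>\<^bsub>R\<^esub> = (\<Oplus>\<^bsub>R\<^esub>g\<in>grade_support G R x. x g)"
    using K a component_zero sum finite_subset[OF supp] by (auto simp: x_def)
  moreover have "grade_support G R z = {}" by (auto simp: grade_support_def z_def)
  then have "z \<in> (\<Pi>\<^sub>E g\<in>carrier G. A g) \<and> finite (grade_support G R z) \<and>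
      \<zero>\<^bsub>R\<^esub> = (\<Oplus>\<^bsub>R\<^esub>g\<in>grade_support G R z. z g)"
    using component_zero by (auto simp: z_def)
  ultimately have "x = z" using unique_decomposition[OF R.zero_closed] by blast
  then have "x g = z g" by simp
  then show ?thesis using g K by (auto simp: x_def z_def)
qed

text \<open>
  Let \<open>c\<close> be the decomposition of \<open>\<one>\<close>.  For \<open>a\<close> of degree \<open>h\<close>, comparison of the components of degree
  \<open>h\<close> in \<open>a = a \<one> = \<Sum>\<^sub>g a c\<^sub>g\<close> shows that \<open>a\<close> times the component of \<open>\<one>\<close> in the identity degree is
  \<open>a\<close>.  That component is therefore a right identity for homogeneous elements, hence for all elements,
  and so it is \<open>\<one>\<close>.
\<close>

lemma one_homogeneous: "\<one>\<^bsub>R\<^esub> \<in> A \<one>\<^bsub>G\<^esub>"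
proof -
  define c where "c = homogeneous_part \<one>\<^bsub>R\<^esub>"
  note c = homogeneous_part[OF R.one_closed, folded c_def]
  define S where "S = insert \<one>\<^bsub>G\<^esub> (grade_support G R c)"
  have S: "finite S" "S \<subseteq> carrier G" using c(3) by (auto simp: S_def grade_support_def)
  have sum_c: "(\<Oplus>\<^bsub>R\<^esub>g\<in>S. c g) = \<one>\<^bsub>R\<^esub>" using S by (intro c(4)) (auto simp: S_def)
  note c_carr = c(2)
  have right_unit: "a \<otimes>\<^bsub>R\<^esub> c \<one>\<^bsub>G\<^esub> = a" if h: "h \<in> carrier G" and a: "a \<in> A h" for a h
  proof -
    have aR: "a \<in> carrier R" using component_subset h a by blast
    \<comment> \<open>\<open>b g\<close> is the component of degree \<open>h \<otimes> g\<close> in a decomposition of \<open>a \<otimes> \<one> \<ominus> a = \<zero>\<close>.\<close>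
    define b where "b g = a \<otimes>\<^bsub>R\<^esub> c g \<oplus>\<^bsub>R\<^esub> (if g = \<one>\<^bsub>G\<^esub> then \<ominus>\<^bsub>R\<^esub> a else \<zero>\<^bsub>R\<^esub>)" for g
    have b: "b g \<in> A (h \<otimes>\<^bsub>G\<^esub> g)" if "g \<in> carrier G" for g
      unfolding b_def
    proof (rule component_add)
      show "a \<otimes>\<^bsub>R\<^esub> c g \<in> A (h \<otimes>\<^bsub>G\<^esub> g)" using that h a c(1) by (intro component_mult)
    qed (use that h a in \<open>auto simp: component_zero component_minus\<close>)
    have inj: "inj_on (\<lambda>g. h \<otimes>\<^bsub>G\<^esub> g) S" using S h by (auto simp: inj_on_def subset_iff)
    have "(\<Oplus>\<^bsub>R\<^esub>k\<in>(\<lambda>g. h \<otimes>\<^bsub>G\<^esub> g) ` S. b (inv\<^bsub>G\<^esub> h \<otimes>\<^bsub>G\<^esub> k))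
        = (\<Oplus>\<^bsub>R\<^esub>g\<in>S. b (inv\<^bsub>G\<^esub> h \<otimes>\<^bsub>G\<^esub> (h \<otimes>\<^bsub>G\<^esub> g)))"
      using inj S h aR c_carr by (intro R.finsum_reindex) (auto simp: b_def)
    also have "\<dots> = (\<Oplus>\<^bsub>R\<^esub>g\<in>S. b g)"
      using S h aR c_carr by (intro R.finsum_cong') (auto simp: b_def G.inv_solve_left' G.m_assoc[symmetric])
    also have "\<dots> = (\<Oplus>\<^bsub>R\<^esub>g\<in>S. a \<otimes>\<^bsub>R\<^esub> c g) \<oplus>\<^bsub>R\<^esub>
        (\<Oplus>\<^bsub>R\<^esub>g\<in>S. if g = \<one>\<^bsub>G\<^esub> then \<ominus>\<^bsub>R\<^esub> a else \<zero>\<^bsub>R\<^esub>)"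
      unfolding b_def using S aR c_carr by (intro R.finsum_addf) auto
    also have "(\<Oplus>\<^bsub>R\<^esub>g\<in>S. a \<otimes>\<^bsub>R\<^esub> c g) = a \<otimes>\<^bsub>R\<^esub> (\<Oplus>\<^bsub>R\<^esub>g\<in>S. c g)"
      using S aR c_carr by (intro R.finsum_rdistr[symmetric]) auto
    also have "(\<Oplus>\<^bsub>R\<^esub>g\<in>S. if g = \<one>\<^bsub>G\<^esub> then \<ominus>\<^bsub>R\<^esub> a else \<zero>\<^bsub>R\<^esub>) = \<ominus>\<^bsub>R\<^esub> a"
      using S aR R.add.finprod_singleton_swap[of "\<one>\<^bsub>G\<^esub>" S "\<lambda>_. \<ominus>\<^bsub>R\<^esub> a", folded finsum_def]
      by (simp add: S_def)
    finally have "(\<Oplus>\<^bsub>R\<^esub>k\<in>(\<lambda>g. h \<otimes>\<^bsub>G\<^esub> g) ` S. b (inv\<^bsub>G\<^esub> h \<otimes>\<^bsub>G\<^esub> k)) = \<zero>\<^bsub>R\<^esub>"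
      using aR by (simp add: sum_c R.r_neg)
    then have "b (inv\<^bsub>G\<^esub> h \<otimes>\<^bsub>G\<^esub> h) = \<zero>\<^bsub>R\<^esub>"
    proof (rule homogeneous_independent[rotated 3])
      show "h \<in> (\<lambda>g. h \<otimes>\<^bsub>G\<^esub> g) ` S" using h by (force simp: S_def)
      fix k assume "k \<in> (\<lambda>g. h \<otimes>\<^bsub>G\<^esub> g) ` S"
      then obtain g where g: "g \<in> carrier G" "k = h \<otimes>\<^bsub>G\<^esub> g" using S by auto
      then have "inv\<^bsub>G\<^esub> h \<otimes>\<^bsub>G\<^esub> k = g" using h by (simp add: G.m_assoc[symmetric])
      then show "b (inv\<^bsub>G\<^esub> h \<otimes>\<^bsub>G\<^esub> k) \<in> A k" using b g by simp
    qed (use S h in auto)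
    then have "a \<otimes>\<^bsub>R\<^esub> c \<one>\<^bsub>G\<^esub> \<oplus>\<^bsub>R\<^esub> \<ominus>\<^bsub>R\<^esub> a = \<zero>\<^bsub>R\<^esub>" using h by (simp add: b_def)
    then show ?thesis using aR c_carr[OF G.one_closed] R.r_right_minus_eq[unfolded R.minus_eq] by simp
  qed
  have "\<one>\<^bsub>R\<^esub> \<otimes>\<^bsub>R\<^esub> c \<one>\<^bsub>G\<^esub> = (\<Oplus>\<^bsub>R\<^esub>g\<in>S. c g \<otimes>\<^bsub>R\<^esub> c \<one>\<^bsub>G\<^esub>)"
    using S c_carr unfolding sum_c[symmetric] by (intro R.finsum_ldistr) auto
  also have "\<dots> = (\<Oplus>\<^bsub>R\<^esub>g\<in>S. c g)"
    using S c_carr c(1) by (intro R.finsum_cong') (auto intro!: right_unit[OF _ c(1)])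
  finally have "c \<one>\<^bsub>G\<^esub> = \<one>\<^bsub>R\<^esub>" using sum_c c_carr by simp
  then show ?thesis using c(1)[OF G.one_closed] by simp
qed

lemma base_subring: "subring (A \<one>\<^bsub>G\<^esub>) R"
proof (rule R.subringI)
  show "a \<otimes>\<^bsub>R\<^esub> b \<in> A \<one>\<^bsub>G\<^esub>" if "a \<in> A \<one>\<^bsub>G\<^esub>" "b \<in> A \<one>\<^bsub>G\<^esub>" for a b
    using component_mult[OF _ _ that] by simp
qed (auto simp: one_homogeneous component_subset component_add component_minus)

lemma ring_base_ring: "ring (base_ring G R A)"
  unfolding base_ring_def by (rule R.subring_is_ring[OF base_subring])

section \<open>Descent of linear systems to the base ring\<close>

theorem underdetermined_solvable_graded:
  assumes am: "amenable G"
    and reg: "\<And>g. g \<in> carrier G \<Longrightarrow> \<exists>r \<in> A g. \<not> left_zero_divisor R r"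
    and base: "underdetermined_solvable (base_ring G R A)"
  shows "underdetermined_solvable R"
  unfolding underdetermined_solvable_def
proof (intro allI impI)
  fix n :: nat and m assume m: "\<forall>j<n. \<forall>i\<le>n. m j i \<in> carrier R"
  interpret B: ring "base_ring G R A" by (rule ring_base_ring)
  from reg obtain r where r: "\<And>g. g \<in> carrier G \<Longrightarrow> r g \<in> A g"
    and "\<And>g. g \<in> carrier G \<Longrightarrow> \<not> left_zero_divisor R (r g)" by metis
  then have rR: "r g \<in> carrier R" if "g \<in> carrier G" for g
    using component_subset that by blast
  have r_cancel: "s = \<zero>\<^bsub>R\<^esub>" if "g \<in> carrier G" "s \<in> carrier R" "r g \<otimes>\<^bsub>R\<^esub> s = \<zero>\<^bsub>R\<^esub>" for g s
    using \<open>\<And>g. g \<in> carrier G \<Longrightarrow> \<not> left_zero_divisor R (r g)\<close> rR that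
    by (auto simp: left_zero_divisor_def)

  define c where "c j i = homogeneous_part (m j i)" for j i
  have mR: "m j i \<in> carrier R" if "j < n" "i \<le> n" for j i using m that by blast
  note c = homogeneous_part_in[OF mR, folded c_def]
    and cR = homogeneous_part_carrier[OF mR, folded c_def]
    and c_fin = homogeneous_part_finite[OF mR, folded c_def]
    and c_sum = homogeneous_part_sum[OF mR, folded c_def]
  define F where "F = (\<Union>j<n. \<Union>i\<le>n. grade_support G R (c j i))"
  have F: "finite F" "F \<subseteq> carrier G" using c_fin by (auto simp: F_def grade_support_def)
  obtain K where K: "finite K" "K \<subseteq> carrier G" "n * card (F <#>\<^bsub>G\<^esub> K) < (n + 1) * card K"
    using amenable_small_expansion[OF am F, of n "n + 1"] by auto
  define H where "H = F <#>\<^bsub>G\<^esub> K"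
  have H: "finite H" "H \<subseteq> carrier G"
    using F K by (auto simp: H_def set_mult_def)
  have quot: "h \<otimes>\<^bsub>G\<^esub> inv\<^bsub>G\<^esub> g \<in> carrier G" if "h \<in> H" "g \<in> K" for h g
    using that H K by auto

  \<comment> \<open>Row \<open>(j, h)\<close> of the new system is the degree \<open>h\<close> part of row \<open>j\<close>: only the component of
    \<open>m j i\<close> in degree \<open>h g\<inverse>\<close> sends the term with \<open>r g\<close> to degree \<open>h\<close>.  The left factor
    moves the result to the identity degree.\<close>
  define coef where "coef = (\<lambda>(j, h) (i, g).
    r (inv\<^bsub>G\<^esub> h) \<otimes>\<^bsub>R\<^esub> (c j i (h \<otimes>\<^bsub>G\<^esub> inv\<^bsub>G\<^esub> g) \<otimes>\<^bsub>R\<^esub> r g))"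
  have coef: "coef q p \<in> A \<one>\<^bsub>G\<^esub>" if q: "q \<in> {..<n} \<times> H" and p: "p \<in> {..n} \<times> K" for q p
  proof -
    obtain j h i g where pq: "q = (j, h)" "p = (i, g)" "j < n" "h \<in> H" "i \<le> n" "g \<in> K"
      using p q by auto
    then have hg: "h \<in> carrier G" "g \<in> carrier G" using H K by auto
    have "coef q p \<in> A (inv\<^bsub>G\<^esub> h \<otimes>\<^bsub>G\<^esub> ((h \<otimes>\<^bsub>G\<^esub> inv\<^bsub>G\<^esub> g) \<otimes>\<^bsub>G\<^esub> g))"
      unfolding coef_def using pq hg by (auto intro!: component_mult r c)
    then show ?thesis using hg by (simp add: G.m_assoc)
  qed
  have "card ({..<n} \<times> H) < card ({..n} \<times> K)"
    using K by (simp add: card_cartesian_product H_def)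
  then obtain y where yB: "\<And>p. p \<in> {..n} \<times> K \<Longrightarrow> y p \<in> carrier (base_ring G R A)"
    and y_nz: "\<exists>p\<in>{..n} \<times> K. y p \<noteq> \<zero>\<^bsub>base_ring G R A\<^esub>"
    and y_sol: "\<And>q. q \<in> {..<n} \<times> H \<Longrightarrow>
      (\<Oplus>\<^bsub>base_ring G R A\<^esub>p\<in>{..n} \<times> K. coef q p \<otimes>\<^bsub>base_ring G R A\<^esub> y p) = \<zero>\<^bsub>base_ring G R A\<^esub>"
    using B.underdetermined_solvableD[OF base, of "{..n} \<times> K" "{..<n} \<times> H" coef] coef H K
    by (auto simp: base_ring_def)
  have y: "y (i, g) \<in> A \<one>\<^bsub>G\<^esub>" if "i \<le> n" "g \<in> K" for i g
    using yB[of "(i, g)"] that by (simp add: base_ring_def)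
  have yR: "y (i, g) \<in> carrier R" if "i \<le> n" "g \<in> K" for i g
    using y[OF that] component_subset[OF G.one_closed] by blast
  have ry: "r g \<otimes>\<^bsub>R\<^esub> y (i, g) \<in> A g" if "i \<le> n" "g \<in> K" for i g
    using component_mult[OF _ G.one_closed r y[OF that]] that K by auto
  have ryR: "r g \<otimes>\<^bsub>R\<^esub> y (i, g) \<in> carrier R" if "i \<le> n" "g \<in> K" for i g
    using ry[OF that] component_subset K that by blast

  define x where "x i = (\<Oplus>\<^bsub>R\<^esub>g\<in>K. r g \<otimes>\<^bsub>R\<^esub> y (i, g))" for i
  have xR: "x i \<in> carrier R" if "i \<le> n" for i
    unfolding x_def using ryR that by (auto intro!: R.finsum_closed)
  have graded_piece: "finsum R (\<lambda>(i, g). c j i (h \<otimes>\<^bsub>G\<^esub> inv\<^bsub>G\<^esub> g) \<otimes>\<^bsub>R\<^esub> (r g \<otimes>\<^bsub>R\<^esub> y (i, g)))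
      ({..n} \<times> K) = \<zero>\<^bsub>R\<^esub>"
    (is "finsum R ?e _ = _") if j: "j < n" and h: "h \<in> H" for j h
  proof (rule r_cancel)
    have eR: "?e p \<in> carrier R" if "p \<in> {..n} \<times> K" for p
      using that j h cR ryR quot by auto
    have hG: "inv\<^bsub>G\<^esub> h \<in> carrier G" using h H by auto
    show "inv\<^bsub>G\<^esub> h \<in> carrier G" by fact
    show "finsum R ?e ({..n} \<times> K) \<in> carrier R" using eR by (intro R.finsum_closed) auto
    have "r (inv\<^bsub>G\<^esub> h) \<otimes>\<^bsub>R\<^esub> finsum R ?e ({..n} \<times> K)
        = (\<Oplus>\<^bsub>R\<^esub>p\<in>{..n} \<times> K. r (inv\<^bsub>G\<^esub> h) \<otimes>\<^bsub>R\<^esub> ?e p)"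
      using K eR rR[OF hG] by (intro R.finsum_rdistr) auto
    also have "\<dots> = (\<Oplus>\<^bsub>R\<^esub>p\<in>{..n} \<times> K. coef (j, h) p \<otimes>\<^bsub>R\<^esub> y p)"
    proof (rule R.finsum_cong')
      fix p assume p: "p \<in> {..n} \<times> K"
      then obtain i g where ig: "p = (i, g)" "i \<le> n" "g \<in> K" by auto
      then show "r (inv\<^bsub>G\<^esub> h) \<otimes>\<^bsub>R\<^esub> ?e p = coef (j, h) p \<otimes>\<^bsub>R\<^esub> y p"
        using cR[OF j] quot[OF h] rR[OF hG] rR[of g] yR K
        by (auto simp: coef_def R.m_assoc subset_iff)
    next
      show "(\<lambda>p. coef (j, h) p \<otimes>\<^bsub>R\<^esub> y p) \<in> {..n} \<times> K \<rightarrow> carrier R"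
        using coef[of "(j, h)"] component_subset[OF G.one_closed] yR j h by fastforce
    qed simp
    also have "\<dots> = (\<Oplus>\<^bsub>base_ring G R A\<^esub>p\<in>{..n} \<times> K. coef (j, h) p \<otimes>\<^bsub>R\<^esub> y p)"
      unfolding base_ring_def
      using coef[of "(j, h)"] y j h K
      by (intro R.finsum_subring[OF base_subring, symmetric])
        (auto intro!: subringE(6)[OF base_subring])
    also have "\<dots> = \<zero>\<^bsub>R\<^esub>"
      using y_sol[of "(j, h)"] j h by (simp add: base_ring_def)
    finally show "r (inv\<^bsub>G\<^esub> h) \<otimes>\<^bsub>R\<^esub> finsum R ?e ({..n} \<times> K) = \<zero>\<^bsub>R\<^esub>" .
  qed
  \<comment> \<open>\<open>H g\<inverse>\<close> contains \<open>F\<close> for each \<open>g \<in> K\<close>, so no component of a coefficient is missed.\<close>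
  have m_split: "m j i = (\<Oplus>\<^bsub>R\<^esub>h\<in>H. c j i (h \<otimes>\<^bsub>G\<^esub> inv\<^bsub>G\<^esub> g))"
    if "j < n" "i \<le> n" "g \<in> K" for j i g
  proof -
    have gG: "g \<in> carrier G" using that K by auto
    have inj: "inj_on (\<lambda>h. h \<otimes>\<^bsub>G\<^esub> inv\<^bsub>G\<^esub> g) H" using H gG by (auto simp: inj_on_def subset_iff)
    have "grade_support G R (c j i) \<subseteq> (\<lambda>h. h \<otimes>\<^bsub>G\<^esub> inv\<^bsub>G\<^esub> g) ` H"
    proof
      fix f assume "f \<in> grade_support G R (c j i)"
      then have f: "f \<in> F" using that by (auto simp: F_def)
      then have "f \<otimes>\<^bsub>G\<^esub> g \<in> H" using that by (auto simp: H_def set_mult_def)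
      moreover have "f = (f \<otimes>\<^bsub>G\<^esub> g) \<otimes>\<^bsub>G\<^esub> inv\<^bsub>G\<^esub> g"
        using f F gG by (simp add: G.m_assoc subset_iff)
      ultimately show "f \<in> (\<lambda>h. h \<otimes>\<^bsub>G\<^esub> inv\<^bsub>G\<^esub> g) ` H" by blast
    qed
    then have "m j i = (\<Oplus>\<^bsub>R\<^esub>f\<in>(\<lambda>h. h \<otimes>\<^bsub>G\<^esub> inv\<^bsub>G\<^esub> g) ` H. c j i f)"
      using H that quot by (intro c_sum[symmetric]) auto
    also have "\<dots> = (\<Oplus>\<^bsub>R\<^esub>h\<in>H. c j i (h \<otimes>\<^bsub>G\<^esub> inv\<^bsub>G\<^esub> g))"
      using inj cR that quot by (intro R.finsum_reindex) auto
    finally show ?thesis .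
  qed
  have row: "(\<Oplus>\<^bsub>R\<^esub>i\<in>{..n}. m j i \<otimes>\<^bsub>R\<^esub> x i) = \<zero>\<^bsub>R\<^esub>" if j: "j < n" for j
  proof -
    let ?e = "\<lambda>h (i, g). c j i (h \<otimes>\<^bsub>G\<^esub> inv\<^bsub>G\<^esub> g) \<otimes>\<^bsub>R\<^esub> (r g \<otimes>\<^bsub>R\<^esub> y (i, g))"
    have eR: "?e h p \<in> carrier R" if "h \<in> H" "p \<in> {..n} \<times> K" for h p
      using that j cR ryR quot by auto
    have "(\<Oplus>\<^bsub>R\<^esub>i\<in>{..n}. m j i \<otimes>\<^bsub>R\<^esub> x i)
        = (\<Oplus>\<^bsub>R\<^esub>i\<in>{..n}. \<Oplus>\<^bsub>R\<^esub>g\<in>K. m j i \<otimes>\<^bsub>R\<^esub> (r g \<otimes>\<^bsub>R\<^esub> y (i, g)))"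
      unfolding x_def using mR[OF j] ryR K
      by (intro R.finsum_cong' R.finsum_rdistr) (auto intro!: R.finsum_closed)
    also have "\<dots> = (\<Oplus>\<^bsub>R\<^esub>i\<in>{..n}. \<Oplus>\<^bsub>R\<^esub>g\<in>K. \<Oplus>\<^bsub>R\<^esub>h\<in>H. ?e h (i, g))"
    proof (intro R.finsum_cong')
      fix i g assume ig: "i \<in> {..n}" "g \<in> K"
      then have "m j i \<otimes>\<^bsub>R\<^esub> (r g \<otimes>\<^bsub>R\<^esub> y (i, g))
          = (\<Oplus>\<^bsub>R\<^esub>h\<in>H. c j i (h \<otimes>\<^bsub>G\<^esub> inv\<^bsub>G\<^esub> g)) \<otimes>\<^bsub>R\<^esub> (r g \<otimes>\<^bsub>R\<^esub> y (i, g))"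
        using m_split[OF j] by simp
      also have "\<dots> = (\<Oplus>\<^bsub>R\<^esub>h\<in>H. ?e h (i, g))"
        using ig H ryR cR[OF j] quot by (simp add: R.finsum_ldistr Pi_iff)
      finally show "m j i \<otimes>\<^bsub>R\<^esub> (r g \<otimes>\<^bsub>R\<^esub> y (i, g)) = (\<Oplus>\<^bsub>R\<^esub>h\<in>H. ?e h (i, g))" .
    qed (use eR in \<open>auto intro!: R.finsum_closed\<close>)
    also have "\<dots> = (\<Oplus>\<^bsub>R\<^esub>p\<in>{..n} \<times> K. \<Oplus>\<^bsub>R\<^esub>h\<in>H. ?e h p)"
      using eR K by (intro R.finsum_Times[symmetric]) (auto intro!: R.finsum_closed)
    also have "\<dots> = (\<Oplus>\<^bsub>R\<^esub>h\<in>H. \<Oplus>\<^bsub>R\<^esub>p\<in>{..n} \<times> K. ?e h p)"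
      using eR K H by (intro R.finsum_finsum_swap) auto
    also have "\<dots> = (\<Oplus>\<^bsub>R\<^esub>h\<in>H. \<zero>\<^bsub>R\<^esub>)"
      using graded_piece[OF j] by (intro R.finsum_cong') auto
    finally show ?thesis by (simp add: R.finsum_zero)
  qed
  obtain i g where ig: "i \<le> n" "g \<in> K" "y (i, g) \<noteq> \<zero>\<^bsub>R\<^esub>"
    using y_nz by (auto simp: base_ring_def)
  have "x i \<noteq> \<zero>\<^bsub>R\<^esub>"
  proof
    assume "x i = \<zero>\<^bsub>R\<^esub>"
    then have "r g \<otimes>\<^bsub>R\<^esub> y (i, g) = \<zero>\<^bsub>R\<^esub>"
      unfolding x_def using ry ig K
      by (intro homogeneous_independent[of K "\<lambda>g. r g \<otimes>\<^bsub>R\<^esub> y (i, g)"]) auto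
    then show False using r_cancel[of g "y (i, g)"] yR ig K by blast
  qed
  with ig(1) show "\<exists>x. (\<forall>i\<le>n. x i \<in> carrier R) \<and> (\<exists>i\<le>n. x i \<noteq> \<zero>\<^bsub>R\<^esub>) \<and>
      (\<forall>j<n. (\<Oplus>\<^bsub>R\<^esub>i\<in>{..n}. m j i \<otimes>\<^bsub>R\<^esub> x i) = \<zero>\<^bsub>R\<^esub>)"
    using xR row by blast
qed

theorem SRC_graded:
  assumes "amenable G" "\<And>g. g \<in> carrier G \<Longrightarrow> \<exists>r \<in> A g. \<not> left_zero_divisor R r"
    and "SRC (base_ring G R A)"
  shows "SRC R"
proof -
  interpret B: ring "base_ring G R A" by (rule ring_base_ring)
  show ?thesis
    using assms underdetermined_solvable_graded B.SRC_imp_underdetermined_solvable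
      R.underdetermined_solvable_imp_SRC by blast
qed

end

section \<open>The opposite ring\<close>

definition opposite_ring :: "('a, 'm) ring_scheme \<Rightarrow> ('a, 'm) ring_scheme" where
  "opposite_ring R = R\<lparr>mult := \<lambda>x y. y \<otimes>\<^bsub>R\<^esub> x\<rparr>"

lemma opposite_ring_simps [simp]:
  "carrier (opposite_ring R) = carrier R"
  "x \<otimes>\<^bsub>opposite_ring R\<^esub> y = y \<otimes>\<^bsub>R\<^esub> x"
  "\<one>\<^bsub>opposite_ring R\<^esub> = \<one>\<^bsub>R\<^esub>"
  "(\<oplus>\<^bsub>opposite_ring R\<^esub>) = (\<oplus>\<^bsub>R\<^esub>)"
  "\<zero>\<^bsub>opposite_ring R\<^esub> = \<zero>\<^bsub>R\<^esub>"
  by (simp_all add: opposite_ring_def)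

lemma add_monoid_opposite_ring: "add_monoid (opposite_ring R) = add_monoid R"
  by (simp add: opposite_ring_def)

lemma finsum_opposite_ring: "finsum (opposite_ring R) = finsum R"
  by (simp add: finsum_def add_monoid_opposite_ring)

lemma ring_opposite_ring:
  assumes "ring R"
  shows "ring (opposite_ring R)"
proof -
  interpret ring R by fact
  show ?thesis
    by (rule ringI)
      (auto intro!: abelian_groupI monoidI
        simp: a_ac m_assoc l_distr r_distr intro: l_neg bexI[of _ "\<ominus>\<^bsub>R\<^esub> _"])
qed

lemma SRC_opposite_ring: "SRC (opposite_ring R) \<longleftrightarrow> LSRC R"
  by (simp add: SRC_def LSRC_def right_module_monos_def left_module_monos_def
      right_smult_def left_smult_def free_add_group_def add_monoid_opposite_ring)

lemma base_ring_opposite_ring: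
  assumes "group G"
  shows "base_ring G (opposite_ring R) (\<lambda>g. A (inv\<^bsub>G\<^esub> g)) = opposite_ring (base_ring G R A)"
  using group.is_monoid[OF assms] by (simp add: base_ring_def opposite_ring_def monoid.inv_one)

lemma left_zero_divisor_opposite_ring:
  "left_zero_divisor (opposite_ring R) r \<longleftrightarrow> right_zero_divisor R r"
  by (simp add: left_zero_divisor_def right_zero_divisor_def)

text \<open>
  Inversion reverses products, which compensates for the reversed multiplication.  Decompositions
  correspond to each other by reindexing along the involution \<open>g \<mapsto> g\<inverse>\<close>.
\<close>

lemma (in graded_ring) graded_opposite_ring:
  "graded_ring G (opposite_ring R) (\<lambda>g. A (inv\<^bsub>G\<^esub> g))"
proof -
  show ?thesis
  proof (intro graded_ring.intro graded_ring_axioms.intro)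
    show "group G" "ring (opposite_ring R)"
      using G.group_axioms ring_opposite_ring[OF R.ring_axioms] .
  next
    fix g assume g: "g \<in> carrier G"
    then show "additive_subgroup (A (inv\<^bsub>G\<^esub> g)) (opposite_ring R)"
      using component_additive_subgroup[of "inv\<^bsub>G\<^esub> g"]
      by (simp add: additive_subgroup_def add_monoid_opposite_ring)
  next
    fix g h a b
    assume "g \<in> carrier G" "h \<in> carrier G" "a \<in> A (inv\<^bsub>G\<^esub> g)" "b \<in> A (inv\<^bsub>G\<^esub> h)"
    then show "a \<otimes>\<^bsub>opposite_ring R\<^esub> b \<in> A (inv\<^bsub>G\<^esub> (g \<otimes>\<^bsub>G\<^esub> h))"
      using component_mult[of "inv\<^bsub>G\<^esub> h" "inv\<^bsub>G\<^esub> g" b a] by (simp add: G.inv_mult_group)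
  next
    fix s assume "s \<in> carrier (opposite_ring R)"
    then have s: "s \<in> carrier R" by simp
    let ?dec = "\<lambda>A x. x \<in> (\<Pi>\<^sub>E g\<in>carrier G. A g) \<and> finite (grade_support G R x) \<and>
      s = (\<Oplus>\<^bsub>R\<^esub>g\<in>grade_support G R x. x g)"
    let ?flip = "\<lambda>x. \<lambda>g\<in>carrier G. x (inv\<^bsub>G\<^esub> g)"
    have flip: "?dec (\<lambda>g. B (inv\<^bsub>G\<^esub> g)) (?flip x)"
      if x: "?dec B x" and B: "\<And>g. g \<in> carrier G \<Longrightarrow> B g \<subseteq> carrier R" for B x
    proof (intro conjI)
      have supp: "grade_support G R x = (\<lambda>g. inv\<^bsub>G\<^esub> g) ` grade_support G R (?flip x)"
      proof (intro equalityI subsetI)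
        fix g assume "g \<in> grade_support G R x"
        then have "inv\<^bsub>G\<^esub> g \<in> grade_support G R (?flip x)" "g = inv\<^bsub>G\<^esub> (inv\<^bsub>G\<^esub> g)"
          by (auto simp: grade_support_def)
        then show "g \<in> (\<lambda>g. inv\<^bsub>G\<^esub> g) ` grade_support G R (?flip x)" by blast
      qed (auto simp: grade_support_def)
      have inj: "inj_on (\<lambda>g. inv\<^bsub>G\<^esub> g) (grade_support G R (?flip x))"
        by (rule inj_on_subset[OF G.inv_inj]) (auto simp: grade_support_def)
      show "finite (grade_support G R (?flip x))"
        using x supp inj finite_imageD by metis
      have xR: "x g \<in> carrier R" if "g \<in> carrier G" for g using x B that by blast
      have "s = (\<Oplus>\<^bsub>R\<^esub>g\<in>(\<lambda>g. inv\<^bsub>G\<^esub> g) ` grade_support G R (?flip x). x g)"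
        using x supp by simp
      also have "\<dots> = (\<Oplus>\<^bsub>R\<^esub>g\<in>grade_support G R (?flip x). x (inv\<^bsub>G\<^esub> g))"
        using inj xR by (intro R.finsum_reindex) (auto simp: grade_support_def)
      also have "\<dots> = (\<Oplus>\<^bsub>R\<^esub>g\<in>grade_support G R (?flip x). ?flip x g)"
        using xR by (intro R.finsum_cong') (auto simp: grade_support_def)
      finally show "s = (\<Oplus>\<^bsub>R\<^esub>g\<in>grade_support G R (?flip x). ?flip x g)" .
      show "?flip x \<in> (\<Pi>\<^sub>E g\<in>carrier G. B (inv\<^bsub>G\<^esub> g))" using x by auto
    qed
    have "\<exists>!x. ?dec (\<lambda>g. A (inv\<^bsub>G\<^esub> g)) x"
    proof -
      obtain x where x: "?dec A x" and unique: "\<And>x'. ?dec A x' \<Longrightarrow> x' = x"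
        using unique_decomposition[OF s] by blast
      show ?thesis
      proof (rule ex1I)
        show "?dec (\<lambda>g. A (inv\<^bsub>G\<^esub> g)) (?flip x)"
          by (rule flip[OF x component_subset])
        fix z assume z: "?dec (\<lambda>g. A (inv\<^bsub>G\<^esub> g)) z"
        have "?dec (\<lambda>g. A (inv\<^bsub>G\<^esub> (inv\<^bsub>G\<^esub> g))) (?flip z)"
          by (rule flip[OF z]) (simp add: component_subset)
        moreover have "(\<Pi>\<^sub>E g\<in>carrier G. A (inv\<^bsub>G\<^esub> (inv\<^bsub>G\<^esub> g))) = (\<Pi>\<^sub>E g\<in>carrier G. A g)"
          by (intro PiE_cong) simp
        ultimately have "?flip z = x" using unique by simp
        then show "z = ?flip x"
          using z by (intro PiE_ext[of z "carrier G" "\<lambda>g. A (inv\<^bsub>G\<^esub> g)"]) (auto split: if_splits)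
      qed
    qed
    then show "\<exists>!x. x \<in> (\<Pi>\<^sub>E g\<in>carrier G. A (inv\<^bsub>G\<^esub> g)) \<and>
        finite (grade_support G (opposite_ring R) x) \<and>
        s = (\<Oplus>\<^bsub>opposite_ring R\<^esub>g\<in>grade_support G (opposite_ring R) x. x g)"
      by (simp add: grade_support_def finsum_opposite_ring)
  qed
qed

theorem propositionA:
  fixes G :: "('g, 'n) monoid_scheme"
    and R :: "('a, 'm) ring_scheme"
    and A :: "'g \<Rightarrow> 'a set"
  assumes "amenable G"
    and "graded_ring G R A"
  shows "((\<forall>g \<in> carrier G. \<exists>r \<in> A g. \<not> left_zero_divisor R r) \<longrightarrow>
            SRC (base_ring G R A) \<longrightarrow> SRC R) \<and>
         ((\<forall>g \<in> carrier G. \<exists>r \<in> A g. \<not> right_zero_divisor R r) \<longrightarrow>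
            LSRC (base_ring G R A) \<longrightarrow> LSRC R)"
proof (intro conjI impI)
  assume "\<forall>g \<in> carrier G. \<exists>r \<in> A g. \<not> left_zero_divisor R r" "SRC (base_ring G R A)"
  then show "SRC R" using graded_ring.SRC_graded[OF assms(2,1)] by blast
next
  interpret graded_ring G R A by fact
  assume reg: "\<forall>g \<in> carrier G. \<exists>r \<in> A g. \<not> right_zero_divisor R r"
    and "LSRC (base_ring G R A)"
  then have "SRC (base_ring G (opposite_ring R) (\<lambda>g. A (inv\<^bsub>G\<^esub> g)))"
    by (simp add: base_ring_opposite_ring[OF G.group_axioms] SRC_opposite_ring)
  then have "SRC (opposite_ring R)"
    using reg graded_ring.SRC_graded[OF graded_opposite_ring assms(1)]
    by (simp add: left_zero_divisor_opposite_ring)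
  then show "LSRC R" by (simp add: SRC_opposite_ring)
qed

end
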